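(* There exists a constant $C>0$, independent of $f$, $\mathbf{s}$ and $n$, such that for every $f\in C(K)$, every $\mathbf{s}\in K$ and every $n\in\mathbb{N}$, $$|F_n^{(\alpha,\beta)}(f;\mathbf{s})-f(\mathbf{s})|\le C\,\omega\!\left(f,\frac1n\right),$$ where $\omega(f,\cdot)$ denotes the modulus of continuity of $f$.
   Context: Sigmoidal function. A measurable function $\eta:\mathbb{R}\to\mathbb{R}$ is sigmoidal if $\lim_{s\to-\infty}\eta(s)=0$ and $\lim_{s\to+\infty}\eta(s)=1$. Throughout, $\eta$ is an increasing sigmoidal function with $\eta(1)<1$ such that: (a) $\eta(s)-\tfrac12$ is an odd function of $s$; (b) $\eta\in C^2(\mathbb{R})$ and $\eta$ is concave on $[0,+\infty)$; (c) there exists $\rho>0$ such that $\eta(s)=\mathcal{O}(|s|^{-1-\rho})$ as $s\to-\infty$. Activation functions. Put $\sigma_\eta(s):=\frac12[\eta(s+1)-\eta(s-1)]$ for $s\in\mathbb{R}$, and $\sigma(\mathbf{s})=\prod_{i=1}^d\sigma_\eta(s_i)$ for $\mathbf{s}=(s_1,\dots,s_d)\in\mathbb{R}^d$, $d\ge1$. Operators. Let $K=\prod_{i=1}^d[a_i,b_i]\subset\mathbb{R}^d$ be a compact rectangular domain, and let $0\le\alpha\le\beta$ be fixed. For $n\in\mathbb{N}$ put $\Lambda_n=\{\mathbf{k}=(k_1,\dots,k_d)\in\mathbb{Z}^d:\lceil na_i\rceil\le k_i\le\lfloor nb_i\rfloor,\ i=1,\dots,d\}$, and for $\mathbf{k}\in\Lambda_n$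 put $$\mathbf{s}_{\mathbf{k},n}^{\alpha,\beta}=\left(\frac{k_1+\alpha}{n+\beta},\dots,\frac{k_d+\alpha}{n+\beta}\right).$$ $C(K)$ is the space of real-valued continuous functions on $K$. For $f\in C(K)$, the multivariate Stancu-type neural network operators are $$F_n^{(\alpha,\beta)}(f;\mathbf{s})=\frac{\sum_{\mathbf{k}\in\Lambda_n}\sigma(n\mathbf{s}-\mathbf{k})\,f(\mathbf{s}_{\mathbf{k},n}^{\alpha,\beta})}{\sum_{\mathbf{k}\in\Lambda_n}\sigma(n\mathbf{s}-\mathbf{k})},\qquad\mathbf{s}\in K.$$ Convention. Since the nodes $\mathbf{s}_{\mathbf{k},n}^{\alpha,\beta}$ may lie outside $K$, whenever $f\in C(K)$ appears in the operators one fixes a bounded continuous extension of $f$ to a neighbourhood of $K$ containing all the nodes that occur, and this extension is still denoted by $f$. Modulus of continuity. For $f\in C(K)$ and $\delta>0$, $$\omega(f,\delta)=\sup_{\|\mathbf{u}-\mathbf{v}\|\le\delta}|f(\mathbf{u})-f(\mathbf{v})|,$$ the supremum being over all pairs of points $\mathbf{u},\mathbf{v}\in K$ at distance at most $\delta$; $\|\cdot\|$ is a fixed norm on $\mathbb{R}^d$.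
   Formalization: False for an arbitrary extension (f=0 on K, nonzero at an outside node). Proved instead, with one C, for n≥1 with Λ_n nonempty: for some extension with ω over K, and for every bounded continuous extension to a convex neighbourhood U of K with ω taken over U. *)

theory Defs
  imports "HOL-Analysis.Analysis" "HOL-Library.Landau_Symbols"
begin

definition is_norm :: "('a::real_vector \<Rightarrow> real) \<Rightarrow> bool" where
  "is_norm N \<longleftrightarrow>
     (\<forall>x. N x \<ge> 0) \<and> (\<forall>x. N x = 0 \<longleftrightarrow> x = 0) \<and>
     (\<forall>c x. N (c *\<^sub>R x) = \<bar>c\<bar> * N x) \<and> (\<forall>x y. N (x + y) \<le> N x + N y)"

definition sigmoidal :: "(real \<Rightarrow> real) \<Rightarrow> bool" where
  "sigmoidal \<eta> \<longleftrightarrow>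
     \<eta> \<in> borel_measurable borel \<and> (\<eta> \<longlongrightarrow> 0) at_bot \<and> (\<eta> \<longlongrightarrow> 1) at_top"

definition C2_function :: "(real \<Rightarrow> real) \<Rightarrow> bool" where
  "C2_function \<eta> \<longleftrightarrow>
     (\<exists>\<eta>' \<eta>''. (\<forall>x. (\<eta> has_real_derivative \<eta>' x) (at x)) \<and>
               (\<forall>x. (\<eta>' has_real_derivative \<eta>'' x) (at x)) \<and>
               continuous_on UNIV \<eta>'')"

text \<open>\<open>mono\<close> is non-strict, so the strictly increasing functions are covered as well.\<close>

definition admissible_sigmoidal :: "(real \<Rightarrow> real) \<Rightarrow> bool" where
  "admissible_sigmoidal \<eta> \<longleftrightarrow>
     sigmoidal \<eta> \<and> mono \<eta> \<and> \<eta> 1 < 1 \<and>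
     (\<forall>s. \<eta> (- s) - 1/2 = - (\<eta> s - 1/2)) \<and>
     C2_function \<eta> \<and> concave_on {0..} \<eta> \<and>
     (\<exists>\<rho>>0. \<eta> \<in> O[at_bot](\<lambda>s. \<bar>s\<bar> powr (- 1 - \<rho>)))"

definition sigma1 :: "(real \<Rightarrow> real) \<Rightarrow> real \<Rightarrow> real" where
  "sigma1 \<eta> s = (\<eta> (s + 1) - \<eta> (s - 1)) / 2"

definition sigma :: "(real \<Rightarrow> real) \<Rightarrow> real ^ 'd \<Rightarrow> real" where
  "sigma \<eta> s = (\<Prod>i\<in>UNIV. sigma1 \<eta> (s $ i))"

definition Lambda :: "real ^ 'd \<Rightarrow> real ^ 'd \<Rightarrow> nat \<Rightarrow> (int ^ 'd) set" where
  "Lambda a b n = {k. \<forall>i. \<lceil>real n * a $ i\<rceil> \<le> k $ i \<and> k $ i \<le> \<lfloor>real n * b $ i\<rfloor>}"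

definition node :: "real \<Rightarrow> real \<Rightarrow> nat \<Rightarrow> int ^ 'd \<Rightarrow> real ^ 'd" where
  "node \<alpha> \<beta> n k = (\<chi> i. (real_of_int (k $ i) + \<alpha>) / (real n + \<beta>))"

text \<open>If \<open>Lambda a b n\<close> is empty, which happens when some \<open>[n a\<^sub>i, n b\<^sub>i]\<close> contains no integer,
  the quotient below is the undefined expression 0/0, with the value 0 in HOL.\<close>

definition stancu_op ::
  "(real \<Rightarrow> real) \<Rightarrow> real \<Rightarrow> real \<Rightarrow> real ^ 'd \<Rightarrow> real ^ 'd \<Rightarrow> nat \<Rightarrow>
     (real ^ 'd \<Rightarrow> real) \<Rightarrow> real ^ 'd \<Rightarrow> real" where
  "stancu_op \<eta> \<alpha> \<beta> a b n f s =
     (\<Sum>k\<in>Lambda a b n.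
        sigma \<eta> (real n *\<^sub>R s - (\<chi> i. real_of_int (k $ i))) * f (node \<alpha> \<beta> n k)) /
     (\<Sum>k\<in>Lambda a b n. sigma \<eta> (real n *\<^sub>R s - (\<chi> i. real_of_int (k $ i))))"

text \<open>\<open>g\<close> is a bounded continuous extension of \<open>f\<close> from the box to a neighbourhood \<open>U\<close> of the box
  that contains the nodes of all the operators at once, so \<open>g\<close> does not depend on \<open>n\<close>.\<close>

definition bounded_extension ::
  "real \<Rightarrow> real \<Rightarrow> real ^ 'd \<Rightarrow> real ^ 'd \<Rightarrow> (real ^ 'd \<Rightarrow> real) \<Rightarrow>
     (real ^ 'd) set \<Rightarrow> (real ^ 'd \<Rightarrow> real) \<Rightarrow> bool" where
  "bounded_extension \<alpha> \<beta> a b f U g \<longleftrightarrow>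
     open U \<and> cbox a b \<subseteq> U \<and> (\<forall>n\<ge>1. \<forall>k\<in>Lambda a b n. node \<alpha> \<beta> n k \<in> U) \<and>
     continuous_on U g \<and> bounded (g ` U) \<and> (\<forall>x\<in>cbox a b. g x = f x)"

definition modulus ::
  "('a::real_vector \<Rightarrow> real) \<Rightarrow> 'a set \<Rightarrow> ('a \<Rightarrow> real) \<Rightarrow> real \<Rightarrow> real" where
  "modulus N S f \<delta> = Sup {\<bar>f u - f v\<bar> |u v. u \<in> S \<and> v \<in> S \<and> N (u - v) \<le> \<delta>}"

end

theory Submission
  imports Defs
begin

text \<open>On a convex set, a chain of at most \<open>1 + n N (u - v)\<close> steps of length at most \<open>1 / n\<close>
  bounds \<open>\<bar>f u - f v\<bar>\<close> by \<open>(1 + n N (u - v)) \<omega>(f, 1 / n)\<close>. Up to constants,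
  \<open>n N (s\<^sub>k - s)\<close> is at most the product of the factors \<open>1 + \<bar>n s\<^sub>i - k\<^sub>i\<bar>\<close>, so the numerator of the
  error splits into a product of one-dimensional first moments of \<open>\<sigma>\<^sub>\<eta>\<close>. The denominator is bounded
  below by the single term of an index \<open>k\<close> with all \<open>\<bar>n s\<^sub>i - k\<^sub>i\<bar> \<le> 1\<close>. The extension for which
  \<open>\<omega>\<close> may be taken over the box alone is the composition of \<open>f\<close> with the metric projection.\<close>

section \<open>Norms and the modulus of continuity\<close>

lemma is_norm_le_norm:
  fixes N :: "'a::euclidean_space \<Rightarrow> real"
  assumes "is_norm N"
  shows "\<exists>M>0. \<forall>x. N x \<le> M * norm x"
proof -
  have nn: "N x \<ge> 0" and sc: "N (c *\<^sub>R x) = \<bar>c\<bar> * N x"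
    and tri: "N (x + y) \<le> N x + N y" for c x y
    using assms by (auto simp: is_norm_def)
  have N0: "N 0 = 0"
    using assms by (auto simp: is_norm_def)
  have sum_le: "N (sum h A) \<le> (\<Sum>i\<in>A. N (h i))" if "finite A" for h and A :: "'a set"
    using that by (induction) (auto simp: N0 intro: order_trans[OF tri])
  \<comment> \<open>The sum over \<open>Basis\<close> comes from expanding \<open>x\<close> in
    coordinates; the added 1 makes positivity of the constant immediate.\<close>
  have "N x \<le> (1 + (\<Sum>b\<in>Basis. N b)) * norm x" for x
  proof -
    have "N x = N (\<Sum>b\<in>Basis. (x \<bullet> b) *\<^sub>R b)"
      by (simp add: euclidean_representation)
    also have "\<dots> \<le> (\<Sum>b\<in>Basis. N ((x \<bullet> b) *\<^sub>R b))"
      by (rule sum_le) simp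
    also have "\<dots> \<le> (\<Sum>b\<in>Basis. norm x * N b)"
      by (rule sum_mono) (auto simp: sc intro!: mult_right_mono nn Basis_le_norm)
    also have "\<dots> = (\<Sum>b\<in>Basis. N b) * norm x"
      by (simp add: sum_distrib_left mult.commute)
    also have "\<dots> \<le> (1 + (\<Sum>b\<in>Basis. N b)) * norm x"
      by (rule mult_right_mono) auto
    finally show ?thesis .
  qed
  moreover have "1 + (\<Sum>b\<in>Basis. N b) > 0"
    using sum_nonneg[of Basis N] nn by (smt (verit))
  ultimately show ?thesis by blast
qed

text \<open>Boundedness of \<open>g\<close> makes the set of differences bounded above; otherwise
  its real-valued \<open>Sup\<close> carries no information.\<close>

lemma modulus_upper:
  assumes "bounded (g ` S)" "u \<in> S" "v \<in> S" "N (u - v) \<le> \<delta>"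
  shows "\<bar>g u - g v\<bar> \<le> modulus N S g \<delta>"
proof -
  obtain B where B: "\<And>x. x \<in> S \<Longrightarrow> \<bar>g x\<bar> \<le> B"
    using assms(1) by (auto simp: bounded_iff)
  have "bdd_above {\<bar>g u - g v\<bar> |u v. u \<in> S \<and> v \<in> S \<and> N (u - v) \<le> \<delta>}"
  proof (rule bdd_aboveI[of _ "2 * B"], clarify)
    fix u v assume "u \<in> S" "v \<in> S"
    then show "\<bar>g u - g v\<bar> \<le> 2 * B"
      using B[of u] B[of v] by linarith
  qed
  then show ?thesis
    unfolding modulus_def by (rule cSup_upper[rotated]) (use assms in blast)
qed

lemma modulus_chain:
  assumes N: "is_norm N" and "convex S" and bdd: "bounded (g ` S)"
    and u: "u \<in> S" and v: "v \<in> S" and n: "n \<ge> (1::nat)"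
  shows "\<bar>g u - g v\<bar> \<le> (1 + real n * N (u - v)) * modulus N S g (1 / real n)"
proof -
  let ?W = "modulus N S g (1 / real n)"
  have nn: "N x \<ge> 0" and sc: "N (c *\<^sub>R x) = \<bar>c\<bar> * N x" and N0: "N 0 = 0" for c x
    using N by (auto simp: is_norm_def)
  have W: "?W \<ge> 0"
    using modulus_upper[of g S u u N "1 / real n"] bdd u by (simp add: N0)
  \<comment> \<open>\<open>Suc\<close> of the floor, rather than the ceiling, keeps \<open>m\<close>
    positive even when \<open>u = v\<close>, so dividing the segment into \<open>m\<close> equal
    pieces always makes sense.\<close>
  define m where "m = Suc (nat \<lfloor>real n * N (u - v)\<rfloor>)"
  have m: "real n * N (u - v) \<le> real m" "real m \<le> 1 + real n * N (u - v)" "m > 0"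
    using nn[of "u - v"] n by (auto simp: m_def) linarith+
  define p where "p j = v + (real j / real m) *\<^sub>R (u - v)" for j
  have pS: "p j \<in> S" if "j \<le> m" for j
  proof -
    have "p j = (1 - real j / real m) *\<^sub>R v + (real j / real m) *\<^sub>R u"
      by (simp add: p_def algebra_simps)
    moreover have "real j / real m \<le> 1"
      using that m by simp
    ultimately show ?thesis
      using \<open>convex S\<close> u v by (simp add: convex_alt)
  qed
  have "\<bar>g (p j) - g v\<bar> \<le> real j * ?W" if "j \<le> m" for j
    using that
  proof (induction j)
    case 0
    then show ?case by (simp add: p_def)
  next
    case (Suc j)
    have "p (Suc j) - p j = (1 / real m) *\<^sub>R (u - v)"
      by (simp add: p_def add_divide_distrib algebra_simps)
    then have "N (p (Suc j) - p j) = N (u - v) / real m"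
      by (simp add: sc)
    also have "\<dots> \<le> 1 / real n"
      using m n by (simp add: field_simps)
    finally have "\<bar>g (p (Suc j)) - g (p j)\<bar> \<le> ?W"
      using modulus_upper[OF bdd] pS Suc.prems by simp
    then show ?case
      using Suc by (simp add: algebra_simps)
  qed
  from this[of m] have "\<bar>g u - g v\<bar> \<le> real m * ?W"
    using m by (simp add: p_def)
  also have "\<dots> \<le> (1 + real n * N (u - v)) * ?W"
    using m W by (intro mult_right_mono)
  finally show ?thesis .
qed

lemma modulus_nonneg:
  assumes "is_norm N" "bounded (g ` S)" "u \<in> S" "\<delta> \<ge> 0"
  shows "modulus N S g \<delta> \<ge> 0"
proof -
  have "N 0 = 0" using assms by (auto simp: is_norm_def)
  then show ?thesis
    using modulus_upper[of g S u u N \<delta>] assms by simp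
qed

section \<open>Sums over boxes of integer vectors\<close>

lemma sum_vec_prod:
  fixes h :: "'d::finite \<Rightarrow> 'b \<Rightarrow> real"
  assumes "\<And>i. finite (S i)"
  shows "(\<Sum>k\<in>{k :: 'b ^ 'd. \<forall>i. k $ i \<in> S i}. \<Prod>i\<in>UNIV. h i (k $ i)) =
         (\<Prod>i\<in>UNIV. \<Sum>x\<in>S i. h i x)"
proof -
  \<comment> \<open>Distributivity is available for functions in \<open>Pi\<^sub>E\<close>; the
    bijection \<open>vec_lambda\<close> carries it over to vectors.\<close>
  have "(\<Prod>i\<in>UNIV. \<Sum>x\<in>S i. h i x) = (\<Sum>p\<in>Pi\<^sub>E UNIV S. \<Prod>i\<in>UNIV. h i (p i))"
    by (rule prod_sum_PiE) (auto simp: assms)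
  also have "\<dots> = (\<Sum>k\<in>{k :: 'b ^ 'd. \<forall>i. k $ i \<in> S i}. \<Prod>i\<in>UNIV. h i (k $ i))"
    by (rule sum.reindex_bij_witness[of _ "\<lambda>k i. k $ i" vec_lambda]) (auto simp: PiE_def)
  finally show ?thesis ..
qed

lemma finite_vec_box:
  assumes "\<And>i. finite (S i)"
  shows "finite {k :: 'b ^ 'd::finite. \<forall>i. k $ i \<in> S i}"
proof -
  have "{k :: 'b ^ 'd. \<forall>i. k $ i \<in> S i} \<subseteq> vec_lambda ` Pi\<^sub>E UNIV S"
    by (auto intro!: image_eqI[of _ _ "vec_nth _"])
  then show ?thesis
    by (rule finite_subset) (auto intro!: finite_imageI finite_PiE assms)
qed

lemma Lambda_eq:
  "Lambda a b n = {k. \<forall>i. k $ i \<in> {\<lceil>real n * a $ i\<rceil>..\<lfloor>real n * b $ i\<rfloor>}}"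
  by (auto simp: Lambda_def)

lemma finite_Lambda: "finite (Lambda a b n)"
  unfolding Lambda_eq by (rule finite_vec_box) simp

text \<open>Each natural number is the absolute value of at most one nonnegative and one negative
  integer, whence the factor 2.\<close>

lemma sum_int_abs_le:
  fixes F :: "nat \<Rightarrow> real"
  assumes "finite S" "\<And>j. F j \<ge> 0" "summable F"
  shows "(\<Sum>m\<in>S. F (nat \<bar>m\<bar>)) \<le> 2 * suminf F"
proof -
  have *: "(\<Sum>m\<in>A. F (nat \<bar>m\<bar>)) \<le> suminf F"
    if "finite A" "inj_on (\<lambda>m. nat \<bar>m\<bar>) A" for A :: "int set"
  proof -
    have "(\<Sum>m\<in>A. F (nat \<bar>m\<bar>)) = sum F ((\<lambda>m. nat \<bar>m\<bar>) ` A)"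
      using that by (simp add: sum.reindex)
    also have "\<dots> \<le> suminf F"
      using assms that by (intro sum_le_suminf) auto
    finally show ?thesis .
  qed
  have "(\<Sum>m\<in>S. F (nat \<bar>m\<bar>)) = (\<Sum>m\<in>S \<inter> {0..}. F (nat \<bar>m\<bar>)) + (\<Sum>m\<in>S \<inter> {..<0}. F (nat \<bar>m\<bar>))"
    using assms(1) by (subst sum.union_disjoint[symmetric]) (auto intro!: sum.cong)
  also have "\<dots> \<le> suminf F + suminf F"
    using assms(1) by (intro add_mono *) (auto simp: inj_on_def)
  finally show ?thesis by simp
qed

section \<open>The one-dimensional kernel: lower bound, decay and first moments\<close>

lemma admissible_sigmoidalD:
  assumes "admissible_sigmoidal \<eta>"
  shows "mono \<eta>" "\<eta> (- s) = 1 - \<eta> s" "concave_on {0..} \<eta>" "0 \<le> \<eta> s" "\<eta> s \<le> 1"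
    "(\<eta> \<longlongrightarrow> 1) at_top"
proof -
  show m: "mono \<eta>" and "concave_on {0..} \<eta>" and lim: "(\<eta> \<longlongrightarrow> 1) at_top"
    using assms by (auto simp: admissible_sigmoidal_def sigmoidal_def)
  have "\<eta> (- s) - 1 / 2 = - (\<eta> s - 1 / 2)"
    using assms unfolding admissible_sigmoidal_def by blast
  then show "\<eta> (- s) = 1 - \<eta> s" by simp
  have lim0: "(\<eta> \<longlongrightarrow> 0) at_bot"
    using assms by (auto simp: admissible_sigmoidal_def sigmoidal_def)
  \<comment> \<open>A monotone function lies between its limits at the two ends.\<close>
  show "\<eta> s \<le> 1"
    by (rule tendsto_lowerbound[OF lim])
      (auto intro!: eventually_mono[OF eventually_ge_at_top[of s]] monoD[OF m])
  show "0 \<le> \<eta> s"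
    by (rule tendsto_upperbound[OF lim0])
      (auto intro!: eventually_mono[OF eventually_le_at_bot[of s]] monoD[OF m])
qed

lemma sigma1_nonneg: "mono \<eta> \<Longrightarrow> sigma1 \<eta> s \<ge> 0"
  using monoD[of \<eta> "s - 1" "s + 1"] by (simp add: sigma1_def)

lemma sigma1_even:
  assumes "admissible_sigmoidal \<eta>"
  shows "sigma1 \<eta> (- s) = sigma1 \<eta> s"
proof -
  have "- s + 1 = - (s - 1)" "- s - 1 = - (s + 1)"
    by simp_all
  then show ?thesis
    unfolding sigma1_def by (simp only: admissible_sigmoidalD(2)[OF assms]) simp
qed

text \<open>If \<open>\<eta> 1\<close> were at most \<open>\<eta> 0 = 1/2\<close>, concavity would
  keep \<open>\<eta>\<close> at or below 1/2 on all of \<open>{1..}\<close>, against the limit 1.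
  The strict inequality makes the lower bound for the denominator positive.\<close>

lemma admissible_sigmoidal_gt_half:
  assumes "admissible_sigmoidal \<eta>"
  shows "\<eta> 1 > 1 / 2"
proof (rule ccontr)
  assume "\<not> \<eta> 1 > 1 / 2"
  note D = admissible_sigmoidalD[OF assms]
  have h0: "\<eta> 0 = 1 / 2"
    using D(2)[of 0] by simp
  have "\<eta> x \<le> 1 / 2" if "x \<ge> 1" for x
  proof -
    \<comment> \<open>The point 1 is written as a convex combination of 0 and
      \<open>x\<close>.\<close>
    have "\<eta> ((1 - 1 / x) *\<^sub>R 0 + (1 / x) *\<^sub>R x) \<ge> (1 - 1 / x) * \<eta> 0 + (1 / x) * \<eta> x"
      by (rule concave_onD[OF D(3)]) (use that in auto)
    then have "(1 - 1 / x) / 2 + \<eta> x / x \<le> \<eta> 1"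
      using that by (simp add: h0)
    with \<open>\<not> \<eta> 1 > 1 / 2\<close> have "(1 - 1 / x) / 2 + \<eta> x / x \<le> 1 / 2"
      by linarith
    moreover have "(1 - 1 / x) / 2 = 1 / 2 - (1 / 2) / x"
      by (simp add: diff_divide_distrib mult.commute)
    ultimately have "\<eta> x / x \<le> (1 / 2) / x"
      by linarith
    then show ?thesis
      using that by (simp only: divide_le_cancel)
  qed
  then have "eventually (\<lambda>x. \<eta> x \<le> 1 / 2) at_top"
    by (rule eventually_at_top_linorderI)
  then have "(1::real) \<le> 1 / 2"
    by (rule tendsto_upperbound[OF D(6)]) simp
  then show False by simp
qed

text \<open>The window from \<open>t - 1\<close> to \<open>t + 1\<close> contains [0, 1] or [-1, 0],
  according to the sign of \<open>t\<close>, and by symmetry \<open>\<eta>\<close> grows by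
  \<open>\<eta> 1 - 1/2\<close> on either.\<close>

lemma sigma1_lower:
  assumes "admissible_sigmoidal \<eta>" "\<bar>t\<bar> \<le> 1"
  shows "sigma1 \<eta> t \<ge> (\<eta> 1 - 1 / 2) / 2"
proof -
  note D = admissible_sigmoidalD[OF assms(1)]
  have h: "\<eta> 0 = 1 / 2" "\<eta> (- 1) = 1 - \<eta> 1"
    using D(2)[of 0] D(2)[of 1] by auto
  show ?thesis
  proof (cases "t \<ge> 0")
    case True
    then show ?thesis
      using monoD[OF D(1), of 1 "t + 1"] monoD[OF D(1), of "t - 1" 0] assms(2) h
      by (simp add: sigma1_def)
  next
    case False
    then show ?thesis
      using monoD[OF D(1), of 0 "t + 1"] monoD[OF D(1), of "t - 1" "-1"] assms(2) h
      by (simp add: sigma1_def)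
  qed
qed

text \<open>Concavity turns the decay of order \<open>-1 - \<rho>\<close> of the tail of \<open>\<eta>\<close> into decay of order
  \<open>-2 - \<rho>\<close> of its increments, so that first moments converge for every \<open>\<rho> > 0\<close>.\<close>

lemma sigma1_le_tail:
  assumes "admissible_sigmoidal \<eta>" "s \<ge> 3"
  shows "sigma1 \<eta> s * (1 + s) \<le> 4 * \<eta> (- ((s - 1) / 2))"
proof -
  note D = admissible_sigmoidalD[OF assms(1)]
  \<comment> \<open>The mean slope of \<open>\<eta>\<close> over [s-1, s+1] is at most that over
    [y, 2y] = [y, s-1]. The latter interval has length \<open>y\<close>, which gains the extra power
    of decay.\<close>
  define y where "y = (s - 1) / 2"
  have y: "y \<ge> 1" "s = 2 * y + 1"
    using assms(2) by (auto simp: y_def field_simps)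
  \<comment> \<open>The weight that makes \<open>s - 1\<close> a convex combination of
    \<open>y\<close> and \<open>s + 1\<close>.\<close>
  define l where "l = y / (y + 2)"
  have l: "0 \<le> l" "l \<le> 1"
    using y by (auto simp: l_def)
  have "(1 - l) *\<^sub>R y + l *\<^sub>R (s + 1) = y + l * (y + 2)"
    using y by (simp add: algebra_simps)
  also have "\<dots> = s - 1"
    using y by (simp add: l_def)
  finally have "\<eta> (s - 1) \<ge> (1 - l) * \<eta> y + l * \<eta> (s + 1)"
    using concave_onD[OF D(3), of l y "s + 1"] y l by simp
  then have "l * (\<eta> (s + 1) - \<eta> (s - 1)) \<le> (1 - l) * (\<eta> (s - 1) - \<eta> y)"
    by (simp add: algebra_simps)
  moreover have "1 - l = 2 / (y + 2)"
    using y by (simp add: l_def field_simps)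
  ultimately have "y * (\<eta> (s + 1) - \<eta> (s - 1)) / (y + 2) \<le> 2 * (\<eta> (s - 1) - \<eta> y) / (y + 2)"
    by (simp add: l_def)
  then have "y * (\<eta> (s + 1) - \<eta> (s - 1)) \<le> 2 * (\<eta> (s - 1) - \<eta> y)"
    using y by (simp add: divide_le_cancel)
  then have "y * sigma1 \<eta> s \<le> \<eta> (s - 1) - \<eta> y"
    by (simp add: sigma1_def)
  also have "\<dots> \<le> \<eta> (- y)"
    using D(2)[of y] D(5)[of "s - 1"] by simp
  finally have "y * sigma1 \<eta> s \<le> \<eta> (- y)" .
  \<comment> \<open>Here 1 + s = 2y + 2 is at most 4y because \<open>y\<close> is at least 1, that
    is, \<open>s\<close> at least 3.\<close>
  moreover have "sigma1 \<eta> s * (1 + s) \<le> sigma1 \<eta> s * (4 * y)"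
    using y by (intro mult_left_mono sigma1_nonneg D) auto
  ultimately show ?thesis
    by (simp add: y_def algebra_simps)
qed

text \<open>The tail estimate settles large \<open>s\<close>, boundedness of the kernel the
  remaining \<open>s \<ge> 0\<close>, and evenness the negative \<open>s\<close>. The base
  \<open>1 + \<bar>s\<bar>\<close> avoids the singularity of the power at 0.\<close>

lemma sigma1_decay:
  assumes "admissible_sigmoidal \<eta>"
  shows "\<exists>C>0. \<exists>\<rho>>0. \<forall>s. sigma1 \<eta> s * (1 + \<bar>s\<bar>) \<le> C * (1 + \<bar>s\<bar>) powr (- 1 - \<rho>)"
proof -
  note D = admissible_sigmoidalD[OF assms]
  obtain \<rho> where \<rho>: "\<rho> > 0" "\<eta> \<in> O[at_bot](\<lambda>s. \<bar>s\<bar> powr (- 1 - \<rho>))"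
    using assms by (auto simp: admissible_sigmoidal_def)
  from \<rho>(2) obtain K where K: "K > 0"
    "eventually (\<lambda>s. norm (\<eta> s) \<le> K * norm (\<bar>s\<bar> powr (- 1 - \<rho>))) at_bot"
    by (elim landau_o.bigE)
  then obtain X where X: "\<And>s. s \<le> X \<Longrightarrow> \<eta> s \<le> K * \<bar>s\<bar> powr (- 1 - \<rho>)"
    by (auto simp: eventually_at_bot_linorder D(4))
  \<comment> \<open>Beyond \<open>L\<close> the tail estimate applies and its argument
    \<open>- ((s - 1) / 2)\<close> lies in the range \<open>{..X}\<close> of the Landau bound. The
    two entries of \<open>C\<close> serve \<open>s \<ge> L\<close> and
    \<open>0 \<le> s < L\<close>.\<close>
  define L where "L = max 3 (1 + 2 * \<bar>X\<bar>)"
  define C where "C = max (4 * K * 4 powr (1 + \<rho>)) ((1 + L) * (1 + L) powr (1 + \<rho>))"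
  have "L \<ge> 3"
    by (simp add: L_def)
  have C: "4 * K * 4 powr (1 + \<rho>) \<le> C" "(1 + L) * (1 + L) powr (1 + \<rho>) \<le> C"
    by (auto simp: C_def)
  have "4 * K * 4 powr (1 + \<rho>) > 0"
    using K by simp
  with C have "C > 0"
    by linarith
  have pos: "sigma1 \<eta> s * (1 + \<bar>s\<bar>) \<le> C * (1 + \<bar>s\<bar>) powr (- 1 - \<rho>)" if "s \<ge> 0" for s
  proof (cases "s \<ge> L")
    case True
    then have "s \<ge> 3" "s \<ge> 1 + 2 * \<bar>X\<bar>"
      by (auto simp: L_def)
    then have s: "s \<ge> 3" "- ((s - 1) / 2) \<le> X"
      using abs_ge_minus_self[of X] by (simp_all add: field_simps)
    have 4: "(4::real) powr (- 1 - \<rho>) * 4 powr (1 + \<rho>) = 1"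
      by (simp flip: powr_add)
    \<comment> \<open>For \<open>s \<ge> 3\<close>, (s-1)/2 is at least (1+s)/4; the negative
      exponent reverses the inequality.\<close>
    have "\<bar>- ((s - 1) / 2)\<bar> powr (- 1 - \<rho>) \<le> ((1 + s) / 4) powr (- 1 - \<rho>)"
      using s \<rho> by (intro powr_mono2') auto
    also have "\<dots> = (1 + s) powr (- 1 - \<rho>) / 4 powr (- 1 - \<rho>)"
      using s by (intro powr_divide)
    also have "\<dots> = (1 + s) powr (- 1 - \<rho>) * 4 powr (1 + \<rho>)"
    proof -
      have "inverse ((4::real) powr (- 1 - \<rho>)) = 4 powr (1 + \<rho>)"
        using 4 by (rule inverse_unique)
      then show ?thesis
        by (simp only: divide_inverse)
    qed
    finally have "K * \<bar>- ((s - 1) / 2)\<bar> powr (- 1 - \<rho>) \<le> K * ((1 + s) powr (- 1 - \<rho>) * 4 powr (1 + \<rho>))"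
      by (rule mult_left_mono) (rule less_imp_le[OF K(1)])
    with sigma1_le_tail[OF assms s(1)] X[OF s(2)]
    have "sigma1 \<eta> s * (1 + s) \<le> 4 * (K * ((1 + s) powr (- 1 - \<rho>) * 4 powr (1 + \<rho>)))"
      by linarith
    also have "\<dots> = (4 * K * 4 powr (1 + \<rho>)) * (1 + s) powr (- 1 - \<rho>)"
      by (simp only: mult_ac)
    also have "\<dots> \<le> C * (1 + s) powr (- 1 - \<rho>)"
      by (rule mult_right_mono[OF C(1)]) simp
    finally show ?thesis using that by simp
  next
    case False
    have "sigma1 \<eta> s \<le> 1"
      using D(5)[of "s + 1"] D(4)[of "s - 1"] by (simp add: sigma1_def)
    then have "sigma1 \<eta> s * (1 + s) \<le> 1 * (1 + L)"
      using False that by (intro mult_mono) auto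
    also have "\<dots> = (1 + L) * (1 + L) powr (1 + \<rho>) * (1 + L) powr (- 1 - \<rho>)"
      using \<open>L \<ge> 3\<close> by (simp add: mult.assoc flip: powr_add)
    also have "\<dots> \<le> C * (1 + L) powr (- 1 - \<rho>)"
      by (rule mult_right_mono[OF C(2)]) simp
    also have "\<dots> \<le> C * (1 + s) powr (- 1 - \<rho>)"
      using False that \<rho> \<open>C > 0\<close> by (intro mult_left_mono powr_mono2') auto
    finally show ?thesis using that by simp
  qed
  have "sigma1 \<eta> s * (1 + \<bar>s\<bar>) \<le> C * (1 + \<bar>s\<bar>) powr (- 1 - \<rho>)" for s
    using pos[of s] pos[of "- s"] sigma1_even[OF assms, of s] by (cases "s \<ge> 0") auto
  then show ?thesis
    using \<open>C > 0\<close> \<rho> by blast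
qed

text \<open>Replacing \<open>t\<close> by its floor turns the sum into one over integer distances,
  so one convergent series bounds it for all \<open>t\<close> and \<open>S\<close>.\<close>

lemma sigma1_moment_bounded:
  assumes "admissible_sigmoidal \<eta>"
  shows "\<exists>B>0. \<forall>t. \<forall>S. finite S \<longrightarrow>
    (\<Sum>k\<in>S. sigma1 \<eta> (t - real_of_int k) * (1 + \<bar>t - real_of_int k\<bar>)) \<le> B"
proof -
  obtain C \<rho> where C: "C > 0" "\<rho> > 0"
    and le: "\<And>s. sigma1 \<eta> s * (1 + \<bar>s\<bar>) \<le> C * (1 + \<bar>s\<bar>) powr (- 1 - \<rho>)"
    using sigma1_decay[OF assms] by blast
  \<comment> \<open>Halving absorbs the rounding of \<open>t\<close>: with j the distance from
    \<open>k\<close> to the floor, 1 + j is at most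
    \<open>2 * (1 + \<bar>t - k\<bar>)\<close>.\<close>
  define F where "F j = C * ((1 + real j) / 2) powr (- 1 - \<rho>)" for j :: nat
  have F: "F j \<ge> 0" for j
    using C by (simp add: F_def)
  have "summable (\<lambda>j. real (Suc j) powr (- 1 - \<rho>))"
    using C by (subst summable_Suc_iff) (simp add: summable_real_powr_iff)
  then have sF: "summable F"
    unfolding F_def using C
    by (simp add: powr_divide add.commute summable_mult summable_divide)
  have "(\<Sum>k\<in>S. sigma1 \<eta> (t - real_of_int k) * (1 + \<bar>t - real_of_int k\<bar>)) \<le> 2 * suminf F"
    if "finite S" for t S
  proof -
    have "(\<Sum>k\<in>S. sigma1 \<eta> (t - real_of_int k) * (1 + \<bar>t - real_of_int k\<bar>)) \<le>
        (\<Sum>k\<in>S. F (nat \<bar>\<lfloor>t\<rfloor> - k\<bar>))"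
    proof (rule sum_mono)
      fix k
      have "\<bar>real_of_int \<lfloor>t\<rfloor> - real_of_int k\<bar> \<le> 1 + \<bar>t - real_of_int k\<bar>"
        by linarith
      also have "\<dots> \<le> 1 + 2 * \<bar>t - real_of_int k\<bar>"
        by simp
      finally have "(1 + real (nat \<bar>\<lfloor>t\<rfloor> - k\<bar>)) / 2 \<le> 1 + \<bar>t - real_of_int k\<bar>"
        by simp
      then have "C * (1 + \<bar>t - real_of_int k\<bar>) powr (- 1 - \<rho>) \<le> F (nat \<bar>\<lfloor>t\<rfloor> - k\<bar>)"
        unfolding F_def using C by (intro mult_left_mono powr_mono2') auto
      with le[of "t - real_of_int k"]
      show "sigma1 \<eta> (t - real_of_int k) * (1 + \<bar>t - real_of_int k\<bar>) \<le> F (nat \<bar>\<lfloor>t\<rfloor> - k\<bar>)"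
        by linarith
    qed
    also have "\<dots> = (\<Sum>m\<in>(\<lambda>k. \<lfloor>t\<rfloor> - k) ` S. F (nat \<bar>m\<bar>))"
      by (simp add: sum.reindex inj_on_def)
    also have "\<dots> \<le> 2 * suminf F"
      using that by (intro sum_int_abs_le F sF) auto
    finally show ?thesis .
  qed
  moreover have "suminf F > 0"
    using C by (intro suminf_pos sF) (auto simp: F_def)
  ultimately show ?thesis
    by (intro exI[of _ "2 * suminf F"]) auto
qed

section \<open>Bounds for the denominator and the weighted numerator\<close>

lemma sigma_nonneg: "admissible_sigmoidal \<eta> \<Longrightarrow> sigma \<eta> s \<ge> 0"
  unfolding sigma_def by (intro prod_nonneg ballI sigma1_nonneg admissible_sigmoidalD(1))

lemma stancu_denominator_lower:
  fixes a b s :: "real ^ 'd"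
  assumes adm: "admissible_sigmoidal \<eta>" and s: "s \<in> cbox a b" and ne: "Lambda a b n \<noteq> {}"
  shows "(\<Sum>k\<in>Lambda a b n. sigma \<eta> (real n *\<^sub>R s - (\<chi> i. real_of_int (k $ i))))
    \<ge> ((\<eta> 1 - 1 / 2) / 2) ^ CARD('d)"
proof -
  have "\<exists>j. \<lceil>real n * a $ i\<rceil> \<le> j \<and> j \<le> \<lfloor>real n * b $ i\<rfloor> \<and> \<bar>real n * s $ i - real_of_int j\<bar> \<le> 1" for i
  proof -
    have le: "real n * a $ i \<le> real n * s $ i" "real n * s $ i \<le> real n * b $ i"
      using s by (auto simp: mem_box_cart intro!: mult_left_mono)
    have ne': "\<lceil>real n * a $ i\<rceil> \<le> \<lfloor>real n * b $ i\<rfloor>"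
    proof -
      obtain k where "k \<in> Lambda a b n"
        using ne by blast
      then have "\<lceil>real n * a $ i\<rceil> \<le> k $ i" "k $ i \<le> \<lfloor>real n * b $ i\<rfloor>"
        by (auto simp: Lambda_def)
      then show ?thesis by linarith
    qed
    show ?thesis
    \<comment> \<open>The floor of \<open>n s_i\<close> serves unless it falls below the index
      range. Then \<open>n s_i\<close> lies between \<open>n a_i\<close> and its ceiling, so that
      ceiling is within distance 1; it is an admissible index because \<open>Lambda a b n\<close> is
      nonempty.\<close>
    proof (cases "\<lceil>real n * a $ i\<rceil> \<le> \<lfloor>real n * s $ i\<rfloor>")
      case True
      then show ?thesis
        using floor_mono[OF le(2)]
        by (intro exI[of _ "\<lfloor>real n * s $ i\<rfloor>"] conjI) linarith+
    next
      case False
      then have "real n * s $ i < \<lceil>real n * a $ i\<rceil>"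
        by linarith
      then show ?thesis
        using le ne'
        by (intro exI[of _ "\<lceil>real n * a $ i\<rceil>"] conjI) linarith+
    qed
  qed
  then obtain j where j: "\<And>i. \<lceil>real n * a $ i\<rceil> \<le> j i \<and> j i \<le> \<lfloor>real n * b $ i\<rfloor>
      \<and> \<bar>real n * s $ i - real_of_int (j i)\<bar> \<le> 1"
    by metis
  define k where "k = (\<chi> i. j i)"
  have k: "k \<in> Lambda a b n"
    using j by (simp add: Lambda_def k_def)
  have "((\<eta> 1 - 1 / 2) / 2) ^ CARD('d) = (\<Prod>i\<in>(UNIV::'d set). (\<eta> 1 - 1 / 2) / 2)"
    by simp
  also have "\<dots> \<le> sigma \<eta> (real n *\<^sub>R s - (\<chi> i. real_of_int (k $ i)))"
    unfolding sigma_def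
  proof (rule prod_mono)
    fix i :: 'd
    have "(\<eta> 1 - 1 / 2) / 2 \<le> sigma1 \<eta> (real n * s $ i - real_of_int (j i))"
      by (rule sigma1_lower[OF adm]) (use j in blast)
    then show "0 \<le> (\<eta> 1 - 1 / 2) / 2 \<and>
        (\<eta> 1 - 1 / 2) / 2 \<le> sigma1 \<eta> ((real n *\<^sub>R s - (\<chi> i. real_of_int (k $ i))) $ i)"
      using admissible_sigmoidal_gt_half[OF adm] by (simp add: k_def)
  qed
  also have "\<dots> \<le> (\<Sum>k\<in>Lambda a b n. sigma \<eta> (real n *\<^sub>R s - (\<chi> i. real_of_int (k $ i))))"
    using k by (intro member_le_sum finite_Lambda sigma_nonneg adm) auto
  finally show ?thesis .
qed

text \<open>A product weight, unlike a norm, lets the sum factor over coordinates by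
  \<open>sum_vec_prod\<close>, leaving one first moment per coordinate.\<close>

lemma stancu_numerator_upper:
  fixes a b s :: "real ^ 'd"
  assumes B: "\<And>t S. finite S \<Longrightarrow>
    (\<Sum>k\<in>S. sigma1 \<eta> (t - real_of_int k) * (1 + \<bar>t - real_of_int k\<bar>)) \<le> B"
    and adm: "admissible_sigmoidal \<eta>"
  shows "(\<Sum>k\<in>Lambda a b n. sigma \<eta> (real n *\<^sub>R s - (\<chi> i. real_of_int (k $ i))) *
    (\<Prod>i\<in>UNIV. 1 + \<bar>real n * s $ i - real_of_int (k $ i)\<bar>)) \<le> B ^ CARD('d)"
proof -
  let ?S = "\<lambda>i. {\<lceil>real n * a $ i\<rceil>..\<lfloor>real n * b $ i\<rfloor>}"
  let ?w = "\<lambda>t. sigma1 \<eta> t * (1 + \<bar>t\<bar>)"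
  have "(\<Sum>k\<in>Lambda a b n. sigma \<eta> (real n *\<^sub>R s - (\<chi> i. real_of_int (k $ i))) *
      (\<Prod>i\<in>UNIV. 1 + \<bar>real n * s $ i - real_of_int (k $ i)\<bar>)) =
      (\<Sum>k\<in>Lambda a b n. \<Prod>i\<in>UNIV. ?w (real n * s $ i - real_of_int (k $ i)))"
    by (simp add: sigma_def prod.distrib)
  also have "\<dots> = (\<Prod>i\<in>UNIV. \<Sum>x\<in>?S i. ?w (real n * s $ i - real_of_int x))"
    unfolding Lambda_eq by (rule sum_vec_prod) simp
  also have "\<dots> \<le> (\<Prod>i\<in>(UNIV::'d set). B)"
    by (intro prod_mono conjI sum_nonneg mult_nonneg_nonneg sigma1_nonneg
        admissible_sigmoidalD(1)[OF adm] B) auto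
  finally show ?thesis by simp
qed

section \<open>The error estimate for an abstract modulus\<close>

lemma node_distance:
  fixes s :: "real ^ 'd"
  assumes "0 \<le> \<alpha>" "\<alpha> \<le> \<beta>" "n \<ge> 1" "norm s \<le> R"
  shows "real n * norm (node \<alpha> \<beta> n k - s) \<le>
    real CARD('d) * (1 + \<alpha> + \<beta> * R) * (\<Prod>i\<in>UNIV. 1 + \<bar>real n * s $ i - real_of_int (k $ i)\<bar>)"
proof -
  let ?t = "\<lambda>i. \<bar>real n * s $ i - real_of_int (k $ i)\<bar>"
  let ?P = "\<Prod>i\<in>UNIV. 1 + ?t i"
  have R: "R \<ge> 0"
    using norm_ge_zero[of s] assms(4) by linarith
  have "real n * norm (node \<alpha> \<beta> n k - s) \<le> real n * (\<Sum>i\<in>UNIV. \<bar>(node \<alpha> \<beta> n k - s) $ i\<bar>)"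
    by (intro mult_left_mono norm_le_l1_cart) simp
  also have "\<dots> = (\<Sum>i\<in>UNIV. real n * \<bar>(node \<alpha> \<beta> n k - s) $ i\<bar>)"
    by (rule sum_distrib_left)
  also have "\<dots> \<le> (\<Sum>i\<in>(UNIV::'d set). (1 + \<alpha> + \<beta> * R) * ?P)"
  proof (rule sum_mono)
    fix i :: 'd
    \<comment> \<open>The Stancu shift adds only \<open>\<alpha> - \<beta> s_i\<close> to the
      numerator, which is bounded on the box; after multiplication by \<open>n\<close> the quotient
      n / (n + \<open>\<beta>\<close>) is at most 1.\<close>
    have "(node \<alpha> \<beta> n k - s) $ i =
        (real_of_int (k $ i) - real n * s $ i + \<alpha> - \<beta> * s $ i) / (real n + \<beta>)"
      using assms by (simp add: node_def field_simps)
    then have "real n * \<bar>(node \<alpha> \<beta> n k - s) $ i\<bar> =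
        (real n / (real n + \<beta>)) * \<bar>real_of_int (k $ i) - real n * s $ i + \<alpha> - \<beta> * s $ i\<bar>"
      using assms by simp
    also have "\<dots> \<le> 1 * \<bar>real_of_int (k $ i) - real n * s $ i + \<alpha> - \<beta> * s $ i\<bar>"
      using assms by (intro mult_right_mono) auto
    also have "\<dots> \<le> ?t i + \<alpha> + \<bar>\<beta> * s $ i\<bar>"
    proof -
      have "\<bar>u - v + \<alpha> - w\<bar> \<le> \<bar>v - u\<bar> + \<alpha> + \<bar>w\<bar>" for u v w
        using assms(1) by linarith
      then show ?thesis by simp
    qed
    also have "\<bar>\<beta> * s $ i\<bar> \<le> \<beta> * R"
      using assms component_le_norm_cart[of s i] by (auto simp: abs_mult intro!: mult_left_mono)
    also have "?t i + \<alpha> + \<beta> * R \<le> (1 + \<alpha> + \<beta> * R) * (1 + ?t i)"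
      using assms R by (simp add: algebra_simps)
    \<comment> \<open>The other factors of the product are at least 1.\<close>
    also have "1 + ?t i \<le> ?P"
    proof -
      have "1 + ?t i = (\<Prod>j\<in>{i}. 1 + ?t j)" by simp
      also have "\<dots> \<le> ?P"
        by (rule prod_mono2) auto
      finally show ?thesis .
    qed
    finally show "real n * \<bar>(node \<alpha> \<beta> n k - s) $ i\<bar> \<le> (1 + \<alpha> + \<beta> * R) * ?P"
      using assms R by (auto simp: mult_left_mono)
  qed
  finally show ?thesis by (simp add: mult.assoc)
qed

text \<open>The number \<open>W\<close> stands for a modulus of continuity over any set, so that one
  constant serves both estimates of the theorem.\<close>

lemma stancu_error:
  fixes a b :: "real ^ 'd"
  assumes adm: "admissible_sigmoidal \<eta>" and ab: "0 \<le> \<alpha>" "\<alpha> \<le> \<beta>" and M: "M > 0"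
  shows "\<exists>C>0. \<forall>g W n. \<forall>s\<in>cbox a b. n \<ge> 1 \<longrightarrow> Lambda a b n \<noteq> {} \<longrightarrow> W \<ge> 0 \<longrightarrow>
    (\<forall>k\<in>Lambda a b n. \<bar>g (node \<alpha> \<beta> n k) - g s\<bar> \<le> (1 + real n * (M * norm (node \<alpha> \<beta> n k - s))) * W) \<longrightarrow>
    \<bar>stancu_op \<eta> \<alpha> \<beta> a b n g s - g s\<bar> \<le> C * W"
proof -
  obtain B where "B > 0" and B: "\<And>t S. finite S \<Longrightarrow>
    (\<Sum>k\<in>S. sigma1 \<eta> (t - real_of_int k) * (1 + \<bar>t - real_of_int k\<bar>)) \<le> B"
    using sigma1_moment_bounded[OF adm] by blast
  obtain R where R: "R > 0" "\<And>s. s \<in> cbox a b \<Longrightarrow> norm s \<le> R"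
    using bounded_cbox[of a b] by (auto simp: bounded_pos)
  define c where "c = ((\<eta> 1 - 1 / 2) / 2) ^ CARD('d)"
  have c: "c > 0"
    using admissible_sigmoidal_gt_half[OF adm] by (simp add: c_def)
  \<comment> \<open>Chosen so that \<open>node_distance\<close> and \<open>?P k \<ge> 1\<close> give
    the bound \<open>A * ?P k\<close> for the factor in front of \<open>W\<close>.\<close>
  define A where "A = 1 + M * (real CARD('d) * (1 + \<alpha> + \<beta> * R))"
  have A: "A > 0"
    using M ab R by (auto simp: A_def intro!: add_pos_nonneg mult_nonneg_nonneg add_nonneg_nonneg)
  define C where "C = A * B ^ CARD('d) / c"
  have "\<bar>stancu_op \<eta> \<alpha> \<beta> a b n g s - g s\<bar> \<le> C * W"
    if s: "s \<in> cbox a b" and n: "n \<ge> 1" and ne: "Lambda a b n \<noteq> {}" and W: "W \<ge> 0"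
      and g: "\<And>k. k \<in> Lambda a b n \<Longrightarrow>
        \<bar>g (node \<alpha> \<beta> n k) - g s\<bar> \<le> (1 + real n * (M * norm (node \<alpha> \<beta> n k - s))) * W"
    for g W n s
  proof -
    let ?v = "\<lambda>k. sigma \<eta> (real n *\<^sub>R s - (\<chi> i. real_of_int (k $ i)))"
    let ?P = "\<lambda>k. \<Prod>i\<in>UNIV. 1 + \<bar>real n * s $ i - real_of_int (k $ i)\<bar>"
    define D where "D = (\<Sum>k\<in>Lambda a b n. ?v k)"
    have D: "D \<ge> c"
      unfolding D_def c_def by (rule stancu_denominator_lower[OF adm s ne])
    \<comment> \<open>The operator reproduces constants, since \<open>D\<close> is nonzero.\<close>
    have "stancu_op \<eta> \<alpha> \<beta> a b n g s - g s =
        (\<Sum>k\<in>Lambda a b n. ?v k * (g (node \<alpha> \<beta> n k) - g s)) / D"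
      using D c by (simp add: stancu_op_def D_def[symmetric] right_diff_distrib sum_subtractf
          diff_divide_distrib flip: sum_distrib_right)
    moreover have "\<bar>\<Sum>k\<in>Lambda a b n. ?v k * (g (node \<alpha> \<beta> n k) - g s)\<bar> \<le> A * B ^ CARD('d) * W"
    proof -
      have "\<bar>\<Sum>k\<in>Lambda a b n. ?v k * (g (node \<alpha> \<beta> n k) - g s)\<bar> \<le>
          (\<Sum>k\<in>Lambda a b n. ?v k * (A * ?P k * W))"
      proof (rule order_trans[OF sum_abs sum_mono])
        fix k assume k: "k \<in> Lambda a b n"
        have "?P k \<ge> 1"
          by (rule prod_ge_1) simp
        moreover have "real n * norm (node \<alpha> \<beta> n k - s) \<le> real CARD('d) * (1 + \<alpha> + \<beta> * R) * ?P k"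
          by (rule node_distance[OF ab n R(2)[OF s]])
        then have "M * (real n * norm (node \<alpha> \<beta> n k - s)) \<le> M * (real CARD('d) * (1 + \<alpha> + \<beta> * R) * ?P k)"
          using M by (intro mult_left_mono) auto
        ultimately have "1 + real n * (M * norm (node \<alpha> \<beta> n k - s)) \<le> A * ?P k"
          unfolding A_def distrib_right by (simp add: mult_ac)
        then have "\<bar>g (node \<alpha> \<beta> n k) - g s\<bar> \<le> A * ?P k * W"
          using g[OF k] W by (meson mult_right_mono order_trans)
        then show "\<bar>?v k * (g (node \<alpha> \<beta> n k) - g s)\<bar> \<le> ?v k * (A * ?P k * W)"
          by (simp add: abs_mult sigma_nonneg[OF adm] mult_left_mono)
      qed
      also have "\<dots> = A * W * (\<Sum>k\<in>Lambda a b n. ?v k * ?P k)"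
        by (simp add: sum_distrib_left mult_ac)
      also have "\<dots> \<le> A * W * B ^ CARD('d)"
        using A W by (intro mult_left_mono stancu_numerator_upper[OF B adm]) auto
      finally show ?thesis by (simp add: mult_ac)
    qed
    ultimately have "\<bar>stancu_op \<eta> \<alpha> \<beta> a b n g s - g s\<bar> \<le> A * B ^ CARD('d) * W / D"
      using D c by (simp add: divide_right_mono)
    also have "\<dots> \<le> A * B ^ CARD('d) * W / c"
      using D c A W \<open>B > 0\<close> by (intro divide_left_mono) auto
    finally show ?thesis by (simp add: C_def)
  qed
  moreover have "C > 0"
    using A c \<open>B > 0\<close> by (simp add: C_def)
  ultimately show ?thesis by blast
qed

section \<open>The projection extension and the two final estimates\<close>

lemma closest_point_extension:
  fixes a b :: "real ^ 'd"
  assumes f: "continuous_on (cbox a b) f" and ne: "cbox a b \<noteq> {}"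
  shows "bounded_extension \<alpha> \<beta> a b f UNIV (\<lambda>x. f (closest_point (cbox a b) x))"
proof -
  have cp: "closest_point (cbox a b) x \<in> cbox a b" for x
    using ne by (intro closest_point_in_set closed_cbox)
  \<comment> \<open>Projection onto a nonempty closed convex set is continuous; the extension takes
    only values of \<open>f\<close> on the box, so it inherits boundedness.\<close>
  have "continuous_on UNIV (\<lambda>x. f (closest_point (cbox a b) x))"
    using f cp by (intro continuous_on_compose2[OF f] continuous_on_closest_point convex_box closed_cbox ne) auto
  moreover have "bounded (f ` cbox a b)"
    using f by (intro compact_imp_bounded compact_continuous_image compact_cbox)
  then have "bounded (range (\<lambda>x. f (closest_point (cbox a b) x)))"
    by (rule bounded_subset) (use cp in auto)
  ultimately show ?thesis
    by (auto simp: bounded_extension_def closest_point_self)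
qed

text \<open>At nodes outside the box, the modulus of \<open>f\<close> over the box does not control
  an arbitrary extension. Hence there are two estimates with a common \<open>C\<close>: one for a
  suitable extension with the modulus over the box, one for every extension to a convex
  \<open>U\<close> with the modulus over \<open>U\<close>. Nonemptiness of
  \<open>Lambda a b n\<close> excludes the quotient 0/0.\<close>

theorem theorem3p5:
  fixes \<eta> :: "real \<Rightarrow> real" and N :: "real ^ 'd \<Rightarrow> real"
    and a b :: "real ^ 'd" and \<alpha> \<beta> :: real
  assumes "admissible_sigmoidal \<eta>"
    and "is_norm N"
    and "\<And>i. a $ i \<le> b $ i"
    and "0 \<le> \<alpha>" and "\<alpha> \<le> \<beta>"
  shows "\<exists>C>0. \<forall>f. continuous_on (cbox a b) f \<longrightarrow>
    (\<exists>U g. bounded_extension \<alpha> \<beta> a b f U g \<and>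
       (\<forall>s\<in>cbox a b. \<forall>n\<ge>1. Lambda a b n \<noteq> {} \<longrightarrow>
          \<bar>stancu_op \<eta> \<alpha> \<beta> a b n g s - f s\<bar> \<le> C * modulus N (cbox a b) f (1 / real n))) \<and>
    (\<forall>U g. bounded_extension \<alpha> \<beta> a b f U g \<and> convex U \<longrightarrow>
       (\<forall>s\<in>cbox a b. \<forall>n\<ge>1. Lambda a b n \<noteq> {} \<longrightarrow>
          \<bar>stancu_op \<eta> \<alpha> \<beta> a b n g s - f s\<bar> \<le> C * modulus N U g (1 / real n)))"
proof -
  obtain M where M: "M > 0" and NM: "\<And>x. N x \<le> M * norm x"
    using is_norm_le_norm[OF assms(2)] by blast
  obtain C where C: "C > 0" and err: "\<And>g W n s. s \<in> cbox a b \<Longrightarrow> n \<ge> 1 \<Longrightarrow> Lambda a b n \<noteq> {} \<Longrightarrow> W \<ge> 0 \<Longrightarrow>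
    (\<And>k. k \<in> Lambda a b n \<Longrightarrow>
      \<bar>g (node \<alpha> \<beta> n k) - g s\<bar> \<le> (1 + real n * (M * norm (node \<alpha> \<beta> n k - s))) * W) \<Longrightarrow>
    \<bar>stancu_op \<eta> \<alpha> \<beta> a b n g s - g s\<bar> \<le> C * W"
    using stancu_error[OF assms(1,4,5) M, of a b] by metis
  have K: "convex (cbox a b)" "closed (cbox a b)" "cbox a b \<noteq> {}"
    using assms(3) by (auto simp: interval_ne_empty_cart)
  let ?p = "closest_point (cbox a b)"
  have p: "?p x \<in> cbox a b" for x
    by (intro closest_point_in_set K)
  have inner: "\<bar>stancu_op \<eta> \<alpha> \<beta> a b n (\<lambda>x. f (?p x)) s - f s\<bar> \<le> C * modulus N (cbox a b) f (1 / real n)"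
    if f: "continuous_on (cbox a b) f" and s: "s \<in> cbox a b" and n: "n \<ge> 1" and ne: "Lambda a b n \<noteq> {}"
    for f s n
  proof -
    let ?W = "modulus N (cbox a b) f (1 / real n)"
    have bdd: "bounded (f ` cbox a b)"
      using f by (intro compact_imp_bounded compact_continuous_image compact_cbox)
    have W: "?W \<ge> 0"
      by (rule modulus_nonneg[OF assms(2) bdd s]) simp
    have ps: "?p s = s"
      by (rule closest_point_self[OF s])
    have "\<bar>f (?p x) - f (?p s)\<bar> \<le> (1 + real n * (M * norm (x - s))) * ?W" for x
    proof -
      have "\<bar>f (?p x) - f s\<bar> \<le> (1 + real n * N (?p x - s)) * ?W"
        by (rule modulus_chain[OF assms(2) K(1) bdd p s n])
      also have "\<dots> \<le> (1 + real n * (M * norm (x - s))) * ?W"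
      proof -
        \<comment> \<open>The projection is nonexpansive for the Euclidean norm but perhaps not for
          \<open>N\<close>, which is why \<open>stancu_error\<close> is phrased with
          \<open>M * norm\<close>. It fixes \<open>s\<close>.\<close>
        have "norm (?p x - s) \<le> norm (x - s)"
          using closest_point_lipschitz[OF K, of x s] by (simp add: ps dist_norm)
        then have "M * norm (?p x - s) \<le> M * norm (x - s)"
          using M by simp
        with NM[of "?p x - s"] have "N (?p x - s) \<le> M * norm (x - s)"
          by linarith
        then show ?thesis
          using W by (intro mult_right_mono add_left_mono mult_left_mono) auto
      qed
      finally show ?thesis by (simp add: ps)
    qed
    then show ?thesis
      using err[OF s n ne W, of "\<lambda>x. f (?p x)"] by (simp add: ps)
  qed
  have outer: "\<bar>stancu_op \<eta> \<alpha> \<beta> a b n g s - f s\<bar> \<le> C * modulus N U g (1 / real n)"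
    if ext: "bounded_extension \<alpha> \<beta> a b f U g" and U: "convex U"
      and s: "s \<in> cbox a b" and n: "n \<ge> 1" and ne: "Lambda a b n \<noteq> {}"
    for f U g s n
  proof -
    let ?W = "modulus N U g (1 / real n)"
    have bdd: "bounded (g ` U)" and sU: "s \<in> U" and gs: "g s = f s"
      and nodes: "\<And>k. k \<in> Lambda a b n \<Longrightarrow> node \<alpha> \<beta> n k \<in> U"
      using ext s n by (auto simp: bounded_extension_def)
    have W: "?W \<ge> 0"
      by (rule modulus_nonneg[OF assms(2) bdd sU]) simp
    \<comment> \<open>Convexity of \<open>U\<close> keeps the chain from \<open>s\<close> to a node
      inside the domain of the extension.\<close>
    have "\<bar>g x - g s\<bar> \<le> (1 + real n * (M * norm (x - s))) * ?W" if "x \<in> U" for x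
    proof -
      have "\<bar>g x - g s\<bar> \<le> (1 + real n * N (x - s)) * ?W"
        by (rule modulus_chain[OF assms(2) U bdd that sU n])
      also have "\<dots> \<le> (1 + real n * (M * norm (x - s))) * ?W"
        using W by (intro mult_right_mono add_left_mono mult_left_mono NM) auto
      finally show ?thesis .
    qed
    then show ?thesis
      using err[OF s n ne W, of g] nodes by (simp add: gs)
  qed
  show ?thesis
    using C inner outer closest_point_extension[OF _ K(3)] by blast
qed

end
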